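(* Let $\mathcal{Q}$ be a nonempty finite set of positive integers with largest element $q$, let $a=|\mathbb{N}_q-\mathcal{Q}|$, and let $p_1<p_2<\cdots<p_a$ be the elements of $\mathbb{N}_q-\mathcal{Q}$. Suppose $p_1=l$ and $p_a=2l$. If either (a) $q=4l-1$ or (b) $p_{a-1}\le q-2l$ where $q<4l-1$, then for all integers $n$ and $k$, $$\begin{aligned}B_{n,k}&=\delta_{n,0}\delta_{k,0}-\delta_{n,2l}\delta_{k,1}+B_{n-1,k}+B_{n-2l,k-1}-B_{n-2l-1,k-1}+B_{n-q-1,k-1}\\&\qquad+B_{n-q-l-1,k-2}+B_{n-q-2l-1,k-3}-B_{n-q-3l-1,k-3}-B_{n-q-4l-1,k-4}\\&\qquad+\sum_{i=2}^{a-1}\left(B_{n-q-p_i-1,k-2}-B_{n-q-2l-p_i-1,k-3}\right),\end{aligned}$$ where the sum is omitted if $a=2$.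
   Context: $\mathbb{N}_q=\{1,2,\ldots,q\}$; $\delta_{i,j}$ is $1$ if $i=j$ and $0$ otherwise. An $N$-board is a linear array of $N$ unit square cells, numbered $1,\ldots,N$ from left to right. A square is a $1\times1$ tile. The comb corresponding to $\mathcal{Q}$ (where $q=\max\mathcal{Q}$) is a tile of length $q+1$ with cells numbered $0,1,\ldots,q$ from left to right, in which cell $0$ is filled and cell $i$ ($1\le i\le q$) is filled if and only if $i\in\mathcal{Q}$; unfilled cells are gaps and are not part of the tile. A restricted-overlap tiling of a board is a placement of tiles on the board (each tile lying entirely within the board) such that every cell of the board is covered by a filled cell of at least one tile, and the leftmost cell of each tile is not covered by any other tile; filled cells that are not the leftmost cells of their tiles are allowed to overlap one another. A tiling is determined by which tiles are placed at which positions. $B_{n,k}$ is the number of restricted-overlap tilings of an $n$-board using squares and exactly $k$ combs corresponding to $\mathcal{Q}$. By convention $B_{0,0}=1$ and $B_{n,k}=0$ if $n<0$, $k<0$ or $n<k$. *)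

theory Defs
  imports Complex_Main
begin

datatype tile = Square | Comb

text \<open>The parameter \<open>Q\<close> is meant to be a nonempty finite set of positive integers. A tile is
  addressed by the board cell occupied by its leftmost cell.\<close>

fun tile_length :: "nat set \<Rightarrow> tile \<Rightarrow> nat" where
  "tile_length Q Square = 1"
| "tile_length Q Comb = Max Q + 1"

fun filled_cells :: "nat set \<Rightarrow> tile \<Rightarrow> nat set" where
  "filled_cells Q Square = {0}"
| "filled_cells Q Comb = insert 0 Q"

definition covered_cells :: "nat set \<Rightarrow> tile \<times> nat \<Rightarrow> nat set" where
  "covered_cells Q x = (\<lambda>i. snd x + i) ` filled_cells Q (fst x)"

text \<open>A tiling is a set of placed tiles. Nothing is lost by using a set rather than a multiset:
  two copies of one tile in the same position would cover each other's leftmost cell.\<close>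

definition restricted_overlap_tiling :: "nat set \<Rightarrow> nat \<Rightarrow> (tile \<times> nat) set \<Rightarrow> bool" where
  "restricted_overlap_tiling Q N T \<longleftrightarrow>
     (\<forall>(t, j)\<in>T. 1 \<le> j \<and> j + tile_length Q t \<le> N + 1) \<and>
     (\<forall>c\<in>{1..N}. \<exists>x\<in>T. c \<in> covered_cells Q x) \<and>
     (\<forall>x\<in>T. \<forall>y\<in>T. x \<noteq> y \<longrightarrow> snd x \<notin> covered_cells Q y)"

definition tilings :: "nat set \<Rightarrow> nat \<Rightarrow> nat \<Rightarrow> (tile \<times> nat) set set" where
  "tilings Q N k =
     {T. restricted_overlap_tiling Q N T \<and> card {x \<in> T. fst x = Comb} = k}"

definition B :: "nat set \<Rightarrow> int \<Rightarrow> int \<Rightarrow> int" where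
  "B Q n k = (if n < 0 \<or> k < 0 \<or> n < k then 0 else int (card (tilings Q (nat n) (nat k))))"

definition kdelta :: "int \<Rightarrow> int \<Rightarrow> int" where
  "kdelta i j = (if i = j then 1 else 0)"

end

theory Submission
  imports Defs
begin

text \<open>A tiling is determined by the set of its comb positions: a set \<open>S \<subseteq> {1..n-q}\<close> in which no two
  elements differ by an element of \<open>Q\<close>. Let \<open>P = {1..q} - Q\<close>. The hypotheses force a sum of two
  elements of \<open>P\<close> to be at most \<open>q\<close>, unless both are \<open>2l\<close>, in which case it exceeds \<open>q\<close>. So cutting
  \<open>S\<close> wherever consecutive elements differ by more than \<open>q\<close> leaves clusters whose sequences of
  consecutive differences are \<open>(d)\<close> for \<open>d \<in> P\<close>, \<open>(l,l)\<close>, or \<open>(2l,\<dots>,2l)\<close> with any number of terms.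
  Splitting by the cluster of the largest possible comb position \<open>m = n-q\<close> gives a recurrence that
  involves the number \<open>f(m,k)\<close> of sets whose cluster at \<open>m\<close> is of the last kind (possibly \<open>{m}\<close>); it satisfies
  \<open>f(m,k) = B(m-1,k-1) + f(m-2l,k-1)\<close>, which eliminates it.\<close>

section \<open>Tilings as sets of comb positions without differences in \<open>Q\<close>\<close>

definition difference_avoiding :: "nat set \<Rightarrow> int set \<Rightarrow> bool" where
  "difference_avoiding Q S \<longleftrightarrow> (\<forall>x\<in>S. \<forall>y\<in>S. x < y \<longrightarrow> y - x \<notin> int ` Q)"

text \<open>Integers throughout, so that shifted arguments may become negative without truncation:
  for \<open>m \<le> 0\<close> just the empty set remains, and for \<open>k < 0\<close>
  nothing.\<close>

definition avoiding_sets :: "nat set \<Rightarrow> int \<Rightarrow> int \<Rightarrow> int set set" where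
  "avoiding_sets Q m k = {S. S \<subseteq> {1..m} \<and> difference_avoiding Q S \<and> int (card S) = k}"

text \<open>The only candidate with combs at \<open>S\<close>: a square consists of its leftmost
  cell, so it may not lie on a cell of a comb, and every cell missed by the combs needs a
  square.\<close>

definition comb_tiling :: "nat set \<Rightarrow> nat \<Rightarrow> nat set \<Rightarrow> (tile \<times> nat) set" where
  "comb_tiling Q N S =
     Pair Comb ` S \<union> Pair Square ` ({1..N} - (\<Union>j\<in>S. covered_cells Q (Comb, j)))"

lemma Comb_in_comb_tiling [simp]: "(Comb, j) \<in> comb_tiling Q N S \<longleftrightarrow> j \<in> S"
  by (auto simp: comb_tiling_def)

lemma Square_in_comb_tiling [simp]:
  "(Square, j) \<in> comb_tiling Q N S \<longleftrightarrow> j \<in> {1..N} \<and> (\<forall>i\<in>S. j \<notin> covered_cells Q (Comb, i))"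
  by (auto simp: comb_tiling_def)

lemma covered_cells_Square [simp]: "covered_cells Q (Square, j) = {j}"
  by (simp add: covered_cells_def)

lemma covered_cells_Comb: "c \<in> covered_cells Q (Comb, j) \<longleftrightarrow> c = j \<or> (j \<le> c \<and> c - j \<in> Q)"
  by (auto simp: covered_cells_def image_iff) (metis le_add_diff_inverse)

lemma restricted_overlap_tiling_determined:
  assumes "restricted_overlap_tiling Q N T"
  shows "T = comb_tiling Q N {j. (Comb, j) \<in> T}"
proof -
  have range: "\<And>t j. (t, j) \<in> T \<Longrightarrow> 1 \<le> j \<and> j + tile_length Q t \<le> N + 1"
    and cover: "\<And>c. c \<in> {1..N} \<Longrightarrow> \<exists>x\<in>T. c \<in> covered_cells Q x"
    and free: "\<And>x y. x \<in> T \<Longrightarrow> y \<in> T \<Longrightarrow> x \<noteq> y \<Longrightarrow> snd x \<notin> covered_cells Q y"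
    using assms unfolding restricted_overlap_tiling_def by blast+
  have "(Square, j) \<in> T \<longleftrightarrow> (Square, j) \<in> comb_tiling Q N {j. (Comb, j) \<in> T}" for j
  proof
    assume j: "(Square, j) \<in> T"
    show "(Square, j) \<in> comb_tiling Q N {j. (Comb, j) \<in> T}"
      using range[OF j] free[OF j] by force
  next
    assume j: "(Square, j) \<in> comb_tiling Q N {j. (Comb, j) \<in> T}"
    then obtain t i where ti: "(t, i) \<in> T" "j \<in> covered_cells Q (t, i)"
      using cover[of j] by auto
    then show "(Square, j) \<in> T"
      using j by (cases t) auto
  qed
  then have "(t, j) \<in> T \<longleftrightarrow> (t, j) \<in> comb_tiling Q N {j. (Comb, j) \<in> T}" for t j
    by (cases t) auto
  then show ?thesis
    unfolding set_eq_iff split_paired_All by blast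
qed

text \<open>A comb has \<open>Max Q + 1\<close> cells, whence the upper limit
  \<open>N - Max Q\<close>. Of two combs, only the left one can cover the leftmost cell of the
  other, and it does so exactly if their distance lies in \<open>Q\<close>.\<close>

lemma restricted_overlap_tiling_Combs:
  assumes "restricted_overlap_tiling Q N T"
  shows "int ` {j. (Comb, j) \<in> T} \<subseteq> {1..int N - int (Max Q)}"
    and "difference_avoiding Q (int ` {j. (Comb, j) \<in> T})"
proof -
  have range: "\<And>t j. (t, j) \<in> T \<Longrightarrow> 1 \<le> j \<and> j + tile_length Q t \<le> N + 1"
    and free: "\<And>x y. x \<in> T \<Longrightarrow> y \<in> T \<Longrightarrow> x \<noteq> y \<Longrightarrow> snd x \<notin> covered_cells Q y"
    using assms unfolding restricted_overlap_tiling_def by blast+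
  show "int ` {j. (Comb, j) \<in> T} \<subseteq> {1..int N - int (Max Q)}"
    using range by fastforce
  have "int j - int i \<notin> int ` Q" if "(Comb, i) \<in> T" "(Comb, j) \<in> T" "i < j" for i j
  proof -
    have "j - i \<notin> Q"
      using free[OF that(2,1)] that(3) by (simp add: covered_cells_Comb)
    moreover have "int j - int i = int (j - i)"
      using that(3) by simp
    ultimately show ?thesis
      by (metis imageE of_nat_eq_iff)
  qed
  then show "difference_avoiding Q (int ` {j. (Comb, j) \<in> T})"
    unfolding difference_avoiding_def by auto
qed

lemma restricted_overlap_comb_tiling:
  assumes "int ` S \<subseteq> {1..int N - int (Max Q)}" and "difference_avoiding Q (int ` S)"
  shows "restricted_overlap_tiling Q N (comb_tiling Q N S)"
  unfolding restricted_overlap_tiling_def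
proof (intro conjI ballI impI)
  fix x assume "x \<in> comb_tiling Q N S"
  then show "case x of (t, j) \<Rightarrow> 1 \<le> j \<and> j + tile_length Q t \<le> N + 1"
    using assms(1) by (auto simp: comb_tiling_def)
next
  fix c assume "c \<in> {1..N}"
  then show "\<exists>x\<in>comb_tiling Q N S. c \<in> covered_cells Q x"
    using Comb_in_comb_tiling Square_in_comb_tiling
    by (metis covered_cells_Square insertI1)
next
  fix x y assume xy: "x \<in> comb_tiling Q N S" "y \<in> comb_tiling Q N S" "x \<noteq> y"
  have free: "j \<notin> covered_cells Q (Comb, i)" if "i \<in> S" "j \<in> S" "i \<noteq> j" for i j
  proof
    assume "j \<in> covered_cells Q (Comb, i)"
    then have "i < j" "j - i \<in> Q"
      using that(3) by (auto simp: covered_cells_Comb)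
    moreover from this have "int j - int i \<in> int ` Q"
      by (metis image_eqI of_nat_diff order_less_imp_le)
    ultimately show False
      using assms(2) that(1,2) by (auto simp: difference_avoiding_def)
  qed
  obtain t j u i where "x = (t, j)" "y = (u, i)"
    by (metis prod.exhaust)
  then show "snd x \<notin> covered_cells Q y"
    using xy free by (cases t; cases u) (auto simp: covered_cells_Comb)
qed

lemma card_tilings: "int (card (tilings Q N k)) = int (card (avoiding_sets Q (int N - int (Max Q)) (int k)))"
proof -
  have Combs: "card {x \<in> T. fst x = Comb} = card (int ` {j. (Comb, j) \<in> T})" for T
  proof -
    have "{x \<in> T. fst x = Comb} = Pair Comb ` {j. (Comb, j) \<in> T}"
      by (auto simp: image_iff)
    then show ?thesis
      by (simp add: card_image inj_on_def)
  qed
  have "bij_betw (\<lambda>T. int ` {j. (Comb, j) \<in> T}) (tilings Q N k)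
          (avoiding_sets Q (int N - int (Max Q)) (int k))"
  proof (rule bij_betw_byWitness[where f' = "\<lambda>S. comb_tiling Q N (nat ` S)"])
    show "\<forall>T\<in>tilings Q N k. comb_tiling Q N (nat ` int ` {j. (Comb, j) \<in> T}) = T"
      by (auto simp: tilings_def image_image simp flip: restricted_overlap_tiling_determined)
    \<comment> \<open>Positions are positive, so \<open>nat\<close> loses nothing.\<close>
    have int_nat: "int ` nat ` S = S" if "S \<subseteq> {1..m}" for S m
      using that by (force simp: image_image image_iff)
    then show "\<forall>S\<in>avoiding_sets Q (int N - int (Max Q)) (int k).
        int ` {j. (Comb, j) \<in> comb_tiling Q N (nat ` S)} = S"
      by (auto simp: avoiding_sets_def)
    show "(\<lambda>T. int ` {j. (Comb, j) \<in> T}) ` tilings Q N k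
        \<subseteq> avoiding_sets Q (int N - int (Max Q)) (int k)"
      using restricted_overlap_tiling_Combs
      unfolding tilings_def avoiding_sets_def image_subset_iff Combs by blast
    show "(\<lambda>S. comb_tiling Q N (nat ` S)) ` avoiding_sets Q (int N - int (Max Q)) (int k)
        \<subseteq> tilings Q N k"
      using restricted_overlap_comb_tiling int_nat Combs
      by (auto simp: tilings_def avoiding_sets_def)
  qed
  then show ?thesis
    by (simp add: bij_betw_same_card)
qed

lemma finite_avoiding_sets [simp]: "finite (avoiding_sets Q m k)"
  by (rule finite_subset[of _ "Pow {1..m}"]) (auto simp: avoiding_sets_def)

lemma avoiding_sets_nonpos: "m \<le> 0 \<Longrightarrow> avoiding_sets Q m k = (if k = 0 then {{}} else {})"
  by (auto simp: avoiding_sets_def difference_avoiding_def)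

text \<open>The conventions for \<open>k < 0\<close> and \<open>n < k\<close> hold automatically, by
  cardinality. The case \<open>n < 0\<close> stays separate because the empty set would otherwise be
  counted for \<open>k = 0\<close>.\<close>

lemma B_eq_avoiding:
  "B Q n k = (if n < 0 then 0 else int (card (avoiding_sets Q (n - int (Max Q)) k)))"
proof -
  have "avoiding_sets Q (n - int (Max Q)) k = {}" if "0 \<le> n" "k < 0 \<or> n < k"
  proof -
    have "int (card S) \<le> n" if "S \<subseteq> {1..n - int (Max Q)}" for S
      using card_mono[OF finite_atLeastAtMost_int that] \<open>0 \<le> n\<close> by simp
    then have "S \<notin> avoiding_sets Q (n - int (Max Q)) k" for S
      using that(2) unfolding avoiding_sets_def mem_Collect_eq by (metis not_less of_nat_0_le_iff)
    then show ?thesis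
      by blast
  qed
  then show ?thesis
    by (cases "n < 0 \<or> k < 0 \<or> n < k") (auto simp: B_def card_tilings)
qed

section \<open>The gap set \<open>P\<close> and the removal of a top cluster\<close>

text \<open>\<open>P_sum\<close> is the common consequence of alternatives (a) and (b). It forces
  two consecutive differences in a cluster, unless both are \<open>2 * l\<close>, to add up to
  another gap; as gaps lie between \<open>l\<close> and \<open>2 * l\<close>, both must then be
  \<open>l\<close>.\<close>

locale comb_gaps =
  fixes Q :: "nat set" and q l :: int and P :: "int set"
  assumes Q_fin: "finite Q" and q_def: "q = int (Max Q)"
    and P_def: "P = {1..q} - int ` Q"
    and l_in: "l \<in> P" and l2_in: "2 * l \<in> P"
    and P_bounds: "d \<in> P \<Longrightarrow> l \<le> d \<and> d \<le> 2 * l"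
    and q_less: "q < 4 * l"
    and P_sum: "d \<in> P \<Longrightarrow> e \<in> P \<Longrightarrow> d + e \<le> q \<or> (d = 2 * l \<and> e = 2 * l)"
begin

abbreviation "W \<equiv> avoiding_sets Q"

lemma l_pos: "0 < l" and l2_le: "2 * l \<le> q"
  using l_in l2_in by (auto simp: P_def)

lemma finite_P [simp]: "finite P"
  by (simp add: P_def)

lemma int_Q_le: "d \<in> int ` Q \<Longrightarrow> d \<le> q"
  using Q_fin by (auto simp: q_def)

lemma B_W: "B Q n k = (if n < 0 then 0 else int (card (W (n - q) k)))"
  by (simp add: B_eq_avoiding q_def)

lemma WD:
  assumes "S \<in> W m k"
  shows W_subset: "S \<subseteq> {1..m}" and W_finite: "finite S" and W_card: "int (card S) = k"
    and W_avoiding: "difference_avoiding Q S"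
  using assms finite_subset[of S "{1..m}"] by (auto simp: avoiding_sets_def)

lemma difference_in_P:
  assumes "difference_avoiding Q S" "x \<in> S" "y \<in> S" "x < y" "y - x \<le> q"
  shows "y - x \<in> P"
  using assms by (auto simp: difference_avoiding_def P_def)

text \<open>Once \<open>C\<close> is known to be all of \<open>S\<close> from \<open>x - q\<close>
  upwards, the rest of \<open>S\<close> lies in \<open>{1..x - 1 - q}\<close>, out of reach of
  \<open>C\<close>, and is an arbitrary avoiding set there. This is the range of comb positions on a
  board of length \<open>x - 1\<close>.\<close>

lemma card_W_cluster:
  assumes "C \<subseteq> {x..m}" "x \<in> C" "difference_avoiding Q C"
  shows "int (card {S \<in> W m k. S \<inter> {x - q..m} = C}) = B Q (x - 1) (k - int (card C))"
proof (cases "1 \<le> x")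
  case False
  \<comment> \<open>No set contains the nonpositive position \<open>x\<close>; correspondingly
    \<open>B\<close> vanishes at the negative length \<open>x - 1\<close>.\<close>
  have "{S \<in> W m k. S \<inter> {x - q..m} = C} = {}"
    using False assms(2) W_subset by fastforce
  then show ?thesis
    using False by (simp add: B_W)
next
  case True
  have q0: "0 < q"
    using l_pos l2_le by simp
  have "finite C"
    using assms(1) finite_subset by blast
  have disj: "C \<inter> S = {}" if "S \<in> W (x - 1 - q) j" for S j
    using W_subset[OF that] assms(1) q0 by fastforce
  have "bij_betw (\<lambda>S. C \<union> S) (W (x - 1 - q) (k - int (card C))) {S \<in> W m k. S \<inter> {x - q..m} = C}"
  proof (rule bij_betw_byWitness[where f' = "\<lambda>S. S - C"])
    show "\<forall>S\<in>W (x - 1 - q) (k - int (card C)). C \<union> S - C = S"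
      using disj by blast
    show "\<forall>S\<in>{S \<in> W m k. S \<inter> {x - q..m} = C}. C \<union> (S - C) = S"
      by blast
    show "(\<lambda>S. C \<union> S) ` W (x - 1 - q) (k - int (card C)) \<subseteq> {S \<in> W m k. S \<inter> {x - q..m} = C}"
    proof safe
      fix S assume S: "S \<in> W (x - 1 - q) (k - int (card C))"
      have sub: "S \<subseteq> {1..x - 1 - q}"
        by (rule W_subset[OF S])
      have xm: "x \<le> m"
        using assms(1,2) by auto
      have "difference_avoiding Q (C \<union> S)"
        unfolding difference_avoiding_def
      proof (intro ballI impI)
        fix u v assume uv: "u \<in> C \<union> S" "v \<in> C \<union> S" "u < v"
        \<comment> \<open>In a mixed pair, \<open>u \<le> x - 1 - q\<close> and
          \<open>x \<le> v\<close>, so the difference exceeds every element of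
          \<open>Q\<close>.\<close>
        consider "u \<in> C" "v \<in> C" | "u \<in> S" "v \<in> S" | "v - u > q"
          using uv sub assms(1) q0 by fastforce
        then show "v - u \<notin> int ` Q"
          using W_avoiding[OF S] assms(3) uv(3) int_Q_le[of "v - u"]
          by cases (auto simp: difference_avoiding_def)
      qed
      moreover have "C \<union> S \<subseteq> {1..m}"
        using sub assms(1) True xm q0 by fastforce
      moreover have "card (C \<union> S) = card C + card S"
        using card_Un_disjoint[OF \<open>finite C\<close> W_finite[OF S] disj[OF S]] .
      ultimately show "C \<union> S \<in> W m k"
        using W_card[OF S] by (simp add: avoiding_sets_def)
      show "u \<in> C" if "u \<in> S" "u \<in> {x - q..m}" for u
        using that sub by fastforce
      show "u \<in> {x - q..m}" if "u \<in> C" for u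
        using that assms(1) q0 by fastforce
    qed
    show "(\<lambda>S. S - C) ` {S \<in> W m k. S \<inter> {x - q..m} = C} \<subseteq> W (x - 1 - q) (k - int (card C))"
    proof safe
      fix S assume S: "S \<in> W m k" and C: "C = S \<inter> {x - q..m}"
      have "S - C \<subseteq> {1..x - 1 - q}"
        using W_subset[OF S] C by fastforce
      moreover have "difference_avoiding Q (S - C)"
        using W_avoiding[OF S] by (simp add: difference_avoiding_def)
      moreover have "int (card (S - C)) = k - int (card C)"
      proof -
        have "C \<subseteq> S" using C by blast
        then show ?thesis
          using card_Diff_subset[OF \<open>finite C\<close>, of S] card_mono[OF W_finite[OF S], of C] W_card[OF S]
          by simp
      qed
      ultimately show "S - S \<inter> {x - q..m} \<in> W (x - 1 - q) (k - int (card (S \<inter> {x - q..m})))"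
        using C by (simp add: avoiding_sets_def)
    qed
  qed
  then show ?thesis
    using True by (simp add: B_W bij_betw_same_card)
qed

section \<open>Clusters with all differences equal to \<open>2 * l\<close>\<close>

text \<open>These are the sets counted by \<open>f\<close>. Restricting the differences from
  \<open>m\<close> alone suffices: a gap \<open>d\<close> other than \<open>2 * l\<close> cannot
  follow \<open>2 * l\<close>, since \<open>2 * l + d\<close> would be at most \<open>q\<close> and
  hence a gap exceeding \<open>2 * l\<close>.\<close>

definition chain_sets :: "int \<Rightarrow> int \<Rightarrow> int set set" where
  "chain_sets m k = {S \<in> W m k. m \<in> S \<and> (\<forall>d\<in>P - {2 * l}. m - d \<notin> S)}"

lemma finite_chain_sets [simp]: "finite (chain_sets m k)"
  by (simp add: chain_sets_def)

lemma difference_avoiding_singleton [simp]: "difference_avoiding Q {x}"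
  by (simp add: difference_avoiding_def)

text \<open>A new top element \<open>m\<close> sees only \<open>m - 2 * l\<close> within reach: the
  next lower element is at least \<open>2 * l\<close> further down, and \<open>q < 4 * l\<close>.
  Conversely, removing \<open>m\<close> leaves a chain by \<open>P_sum\<close>.\<close>

lemma chain_sets_extend:
  "bij_betw (insert m) (chain_sets (m - 2 * l) (k - 1)) {S \<in> chain_sets m k. m - 2 * l \<in> S}"
proof (rule bij_betw_byWitness[where f' = "\<lambda>S. S - {m}"])
  have sub: "S \<subseteq> {1..m - 2 * l}" if "S \<in> chain_sets (m - 2 * l) (k - 1)" for S
    using that by (auto simp: chain_sets_def dest: W_subset)
  then show "\<forall>S\<in>chain_sets (m - 2 * l) (k - 1). insert m S - {m} = S"
    using l_pos by fastforce
  show "\<forall>S\<in>{S \<in> chain_sets m k. m - 2 * l \<in> S}. insert m (S - {m}) = S"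
    by (auto simp: chain_sets_def)
  show "insert m ` chain_sets (m - 2 * l) (k - 1) \<subseteq> {S \<in> chain_sets m k. m - 2 * l \<in> S}"
  proof (rule image_subsetI)
    fix S assume "S \<in> chain_sets (m - 2 * l) (k - 1)"
    note sub = sub[OF this]
    have W: "S \<in> W (m - 2 * l) (k - 1)" and top: "m - 2 * l \<in> S"
      and gap: "\<And>d. d \<in> P \<Longrightarrow> d \<noteq> 2 * l \<Longrightarrow> m - 2 * l - d \<notin> S"
      using \<open>S \<in> _\<close> by (auto simp: chain_sets_def)
    have new: "m - u \<notin> int ` Q" if "u \<in> S" for u
    proof (cases "u = m - 2 * l")
      case True
      then show ?thesis using l2_in by (simp add: P_def)
    next
      case False
      then have "u < m - 2 * l"
        using sub that by fastforce
      then have "m - 2 * l - u > q \<or> m - 2 * l - u \<in> P"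
        using difference_in_P[OF W_avoiding[OF W] that top] by linarith
      moreover have "m - 2 * l - u \<in> P \<Longrightarrow> m - 2 * l - u = 2 * l"
        using gap[of "m - 2 * l - u"] that by auto
      ultimately have "m - u > q"
        using q_less l_pos by linarith
      then show ?thesis
        using int_Q_le[of "m - u"] by linarith
    qed
    have m: "m \<notin> S" "\<And>u. u \<in> S \<Longrightarrow> u < m"
      using sub l_pos by fastforce+
    have "difference_avoiding Q (insert m S)"
      using W_avoiding[OF W] new m(2) unfolding difference_avoiding_def
      by (metis insert_iff order_less_asym)
    moreover have "insert m S \<subseteq> {1..m}"
      using sub top l_pos by fastforce
    moreover have "int (card (insert m S)) = k"
      using W_card[OF W] W_finite[OF W] m(1) by simp
    moreover have "m - d \<notin> insert m S" if "d \<in> P" "d \<noteq> 2 * l" for d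
      using P_bounds[OF that(1)] that(2) sub l_pos by fastforce
    ultimately show "insert m S \<in> {S \<in> chain_sets m k. m - 2 * l \<in> S}"
      using top by (simp add: chain_sets_def avoiding_sets_def)
  qed
  show "(\<lambda>S. S - {m}) ` {S \<in> chain_sets m k. m - 2 * l \<in> S} \<subseteq> chain_sets (m - 2 * l) (k - 1)"
  proof (rule image_subsetI)
    fix S assume "S \<in> {S \<in> chain_sets m k. m - 2 * l \<in> S}"
    then have second: "m - 2 * l \<in> S" and W: "S \<in> W m k" and top: "m \<in> S"
      and gap: "\<And>d. d \<in> P \<Longrightarrow> d \<noteq> 2 * l \<Longrightarrow> m - d \<notin> S"
      by (auto simp: chain_sets_def)
    have diff: "m - u > q \<or> m - u = 2 * l" if "u \<in> S" "u < m" for u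
      using difference_in_P[OF W_avoiding[OF W] that(1) top that(2)] gap[of "m - u"] that(1)
      by (cases "m - u \<le> q") auto
    have "S - {m} \<subseteq> {1..m - 2 * l}"
    proof
      fix u assume u: "u \<in> S - {m}"
      then have "1 \<le> u" "u < m"
        using W_subset[OF W] by force+
      then show "u \<in> {1..m - 2 * l}"
        using diff[of u] u l2_le by auto
    qed
    moreover have "difference_avoiding Q (S - {m})"
      using W_avoiding[OF W] by (simp add: difference_avoiding_def)
    moreover have "int (card (S - {m})) = k - 1"
      using W_card[OF W] card.remove[OF W_finite[OF W] top] by simp
    \<comment> \<open>Such an element would have distance \<open>2 * l + d\<close> from
      \<open>m\<close>, which \<open>P_sum\<close> bounds by \<open>q\<close> although it is larger
      than \<open>2 * l\<close>, contradicting \<open>diff\<close>.\<close>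
    moreover have "m - 2 * l - d \<notin> S" if "d \<in> P" "d \<noteq> 2 * l" for d
      using diff[of "m - 2 * l - d"] P_sum[OF l2_in that(1)] P_bounds[OF that(1)] that(2) l_pos
      by auto
    ultimately show "S - {m} \<in> chain_sets (m - 2 * l) (k - 1)"
      using second l_pos by (simp add: chain_sets_def avoiding_sets_def)
  qed
qed

text \<open>Either the chain stops at once, with \<open>{m}\<close> as the whole cluster, or it
  continues at \<open>m - 2 * l\<close>.\<close>

lemma card_chain_sets:
  "int (card (chain_sets m k)) = B Q (m - 1) (k - 1) + int (card (chain_sets (m - 2 * l) (k - 1)))"
proof -
  have "{S \<in> chain_sets m k. m - 2 * l \<notin> S} = {S \<in> W m k. S \<inter> {m - q..m} = {m}}"
  proof safe
    fix S u assume S: "S \<in> chain_sets m k" "m - 2 * l \<notin> S"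
    then show "S \<in> W m k" by (simp add: chain_sets_def)
    assume u: "u \<in> S" "u \<in> {m - q..m}"
    show "u = m"
    proof (rule ccontr)
      assume "u \<noteq> m"
      then have "m - u \<in> P"
        using S u by (intro difference_in_P[of S]) (auto simp: chain_sets_def W_avoiding)
      then have "m - u = 2 * l \<or> m - (m - u) \<notin> S"
        using S(1) unfolding chain_sets_def by blast
      then have "u = m - 2 * l"
        using u(1) by auto
      then show False
        using S(2) u(1) by simp
    qed
  next
    fix S assume "S \<in> chain_sets m k"
    then show "m \<in> S" "m \<in> {m - q..m}"
      using l_pos l2_le by (auto simp: chain_sets_def)
  next
    fix S assume S: "S \<in> W m k" "S \<inter> {m - q..m} = {m}"
    have "m - d \<notin> S" if "d \<in> P" for d
    proof -
      have "m - d \<in> {m - q..m} - {m}"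
        using that by (auto simp: P_def)
      then show ?thesis
        using S(2) by blast
    qed
    then show "S \<in> chain_sets m k"
      using S by (auto simp: chain_sets_def)
    show "False" if "m - 2 * l \<in> S"
      using that l2_in \<open>\<And>d. d \<in> P \<Longrightarrow> m - d \<notin> S\<close> by blast
  qed
  then have "int (card {S \<in> chain_sets m k. m - 2 * l \<notin> S}) = B Q (m - 1) (k - 1)"
    using card_W_cluster[of "{m}" m m k] by simp
  moreover have "card {S \<in> chain_sets m k. m - 2 * l \<in> S} = card (chain_sets (m - 2 * l) (k - 1))"
    using bij_betw_same_card[OF chain_sets_extend] by simp
  moreover have "card (chain_sets m k)
      = card {S \<in> chain_sets m k. m - 2 * l \<notin> S} + card {S \<in> chain_sets m k. m - 2 * l \<in> S}"
    by (subst card_Un_disjoint[symmetric]) (auto intro: arg_cong[where f = card])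
  ultimately show ?thesis
    by simp
qed

section \<open>Clusters with a first difference other than \<open>2 * l\<close>\<close>

text \<open>An element between \<open>m - d\<close> and \<open>m\<close> would split
  \<open>d < 2 * l\<close> into two gaps of size at least \<open>l\<close>. One at a gap
  \<open>e\<close> below \<open>m - d\<close> makes \<open>d + e\<close> a gap by
  \<open>P_sum\<close>, so \<open>d + e \<le> 2 * l\<close> and \<open>d = e = l\<close>.\<close>

lemma pair_cluster:
  assumes "d \<in> P" "d \<noteq> 2 * l"
    and S: "S \<in> W m k" "m \<in> S" "m - d \<in> S" and u: "u \<in> S" "u \<in> {m - d - q..m}"
  shows "u = m \<or> u = m - d \<or> (d = l \<and> u = m - 2 * l)"
proof (rule ccontr)
  assume neg: "\<not> ?thesis"
  note diff = difference_in_P[OF W_avoiding[OF S(1)]]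
  have d: "l \<le> d" "d < 2 * l"
    using P_bounds[OF assms(1)] assms(2) by auto
  show False
  proof (cases "m - d < u")
    case True
    then have "m - u \<in> P" "u - (m - d) \<in> P"
      using neg u S d l_pos l2_le by (auto intro!: diff)
    then show False
      using P_bounds[of "m - u"] P_bounds[of "u - (m - d)"] d by linarith
  next
    case False
    then have e: "m - d - u \<in> P"
      using neg u S by (auto intro!: diff)
    then have "m - u \<le> q"
      using P_sum[OF assms(1) e] assms(2) by auto
    then have "m - u \<in> P"
      using neg u S by (auto intro!: diff)
    then show False
      using P_bounds[of "m - u"] P_bounds[OF e] neg d by auto
  qed
qed

text \<open>The negated condition removes the only case in which the pair is not the whole cluster,
  namely the differences \<open>l, l\<close>.\<close>

lemma card_pair_cluster:
  assumes "d \<in> P" "d \<noteq> 2 * l"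
  shows "int (card {S \<in> W m k. m \<in> S \<and> m - d \<in> S \<and> \<not> (d = l \<and> m - 2 * l \<in> S)})
    = B Q (m - d - 1) (k - 2)"
proof -
  have d: "0 < d"
    using assms(1) by (auto simp: P_def)
  have "difference_avoiding Q {m - d, m}"
    using assms(1) d by (auto simp: difference_avoiding_def P_def)
  then have "int (card {S \<in> W m k. S \<inter> {m - d - q..m} = {m - d, m}}) = B Q (m - d - 1) (k - 2)"
    using card_W_cluster[of "{m - d, m}" "m - d" m k] d by simp
  moreover
  have "S \<inter> {m - d - q..m} = {m - d, m}
      \<longleftrightarrow> m \<in> S \<and> m - d \<in> S \<and> \<not> (d = l \<and> m - 2 * l \<in> S)" (is "?L \<longleftrightarrow> ?R") if "S \<in> W m k" for S
  proof
    assume L: ?L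
    have "m - 2 * l \<notin> S" if "d = l"
    proof
      assume "m - 2 * l \<in> S"
      moreover have "m - 2 * l \<in> {m - d - q..m}"
        using that l_pos l2_le by simp
      ultimately have "m - 2 * l \<in> {m - d, m}"
        using L by blast
      then show False
        using l_pos that by simp
    qed
    then show ?R using L by blast
  next
    assume ?R
    moreover have "m - d \<in> {m - d - q..m}" "m \<in> {m - d - q..m}"
      using d l_pos l2_le by auto
    ultimately show ?L
      using pair_cluster[OF assms \<open>S \<in> W m k\<close>] by blast
  qed
  then have "{S \<in> W m k. S \<inter> {m - d - q..m} = {m - d, m}}
      = {S \<in> W m k. m \<in> S \<and> m - d \<in> S \<and> \<not> (d = l \<and> m - 2 * l \<in> S)}"
    by (intro Collect_cong conj_cong refl)
  ultimately show ?thesis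
    by simp
qed

lemma card_triple_cluster:
  "int (card {S \<in> W m k. m \<in> S \<and> m - l \<in> S \<and> m - 2 * l \<in> S}) = B Q (m - 2 * l - 1) (k - 3)"
proof -
  have "difference_avoiding Q {m - 2 * l, m - l, m}"
    using l_in l2_in by (auto simp: difference_avoiding_def P_def)
  then have "int (card {S \<in> W m k. S \<inter> {m - 2 * l - q..m} = {m - 2 * l, m - l, m}})
      = B Q (m - 2 * l - 1) (k - 3)"
    using card_W_cluster[of "{m - 2 * l, m - l, m}" "m - 2 * l" m k] l_pos by simp
  moreover
  have "S \<inter> {m - 2 * l - q..m} = {m - 2 * l, m - l, m}
      \<longleftrightarrow> m \<in> S \<and> m - l \<in> S \<and> m - 2 * l \<in> S" (is "?L \<longleftrightarrow> ?R") if S: "S \<in> W m k" for S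
  proof
    assume R: ?R
    have "u \<in> {m - 2 * l, m - l, m}" if u: "u \<in> S" "u \<in> {m - 2 * l - q..m}" for u
    proof (cases "m - l - q \<le> u")
      case True
      then show ?thesis
        using pair_cluster[OF l_in _ S] R u l_pos by auto
    next
      \<comment> \<open>Here \<open>u\<close> is too low for \<open>pair_cluster\<close>, but within
        reach of \<open>m - 2 * l\<close>. It would be at a gap \<open>e\<close> below
        \<open>m - 2 * l\<close> with \<open>l + e > q\<close>, against
        \<open>P_sum\<close>.\<close>
      case False
      then have e: "m - 2 * l - u \<in> P"
        using u R l_pos l2_le by (auto intro!: difference_in_P[OF W_avoiding[OF S]])
      then show ?thesis
        using False P_sum[OF l_in e] l_pos by auto
    qed
    moreover have "{m - 2 * l, m - l, m} \<subseteq> {m - 2 * l - q..m}"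
      using l_pos l2_le by auto
    ultimately show ?L
      using R by blast
  qed blast
  then have "{S \<in> W m k. S \<inter> {m - 2 * l - q..m} = {m - 2 * l, m - l, m}}
      = {S \<in> W m k. m \<in> S \<and> m - l \<in> S \<and> m - 2 * l \<in> S}"
    by (intro Collect_cong conj_cong refl)
  ultimately show ?thesis
    by simp
qed

text \<open>The sets are sorted by the cluster of \<open>m\<close>: a chain, a pair with difference
  \<open>d\<close>, or the triple with differences \<open>l, l\<close>. The value \<open>d\<close>
  is unique, because two gaps other than \<open>2 * l\<close> differ by less than \<open>l\<close>,
  while the difference of the two elements below \<open>m\<close> would itself be a gap.\<close>

lemma card_W_top:
  "int (card {S \<in> W m k. m \<in> S}) =
    int (card (chain_sets m k)) + (\<Sum>d\<in>P - {2 * l}. B Q (m - d - 1) (k - 2)) + B Q (m - 2 * l - 1) (k - 3)"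
proof -
  let ?D = "P - {2 * l}"
  let ?A = "\<lambda>d. {S \<in> W m k. m \<in> S \<and> m - d \<in> S \<and> \<not> (d = l \<and> m - 2 * l \<in> S)}"
  let ?T = "{S \<in> W m k. m \<in> S \<and> m - l \<in> S \<and> m - 2 * l \<in> S}"
  have unique: "d = e" if "S \<in> W m k" "m - d \<in> S" "m - e \<in> S" "d \<in> ?D" "e \<in> ?D" for S d e
  proof -
    have *: False if "d \<in> ?D" "e \<in> ?D" "d < e" "m - d \<in> S" "m - e \<in> S" for d e
    proof -
      have "l \<le> d" "e < 2 * l"
        using P_bounds[of d] P_bounds[of e] that by auto
      moreover have "(m - d) - (m - e) \<in> P"
        using that calculation l2_le l_pos by (intro difference_in_P[OF W_avoiding[OF \<open>S \<in> W m k\<close>]]) auto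
      ultimately show False
        using P_bounds[of "(m - d) - (m - e)"] by auto
    qed
    show ?thesis
      using that *[of d e] *[of e d] by (cases d e rule: linorder_cases) auto
  qed
  have l_D: "l \<in> ?D"
    using l_in l_pos by simp
  \<comment> \<open>What \<open>?A l\<close> leaves out is exactly \<open>?T\<close>.\<close>
  have split: "{S \<in> W m k. m \<in> S} = chain_sets m k \<union> (\<Union> (?A ` ?D) \<union> ?T)"
    using l_D by (auto simp: chain_sets_def)
  have "card {S \<in> W m k. m \<in> S} = card (chain_sets m k) + card (\<Union> (?A ` ?D) \<union> ?T)"
    unfolding split using l_D by (intro card_Un_disjoint) (auto simp: chain_sets_def)
  also have "card (\<Union> (?A ` ?D) \<union> ?T) = card (\<Union> (?A ` ?D)) + card ?T"
    using unique[OF _ _ _ _ l_D] by (intro card_Un_disjoint) auto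
  also have "card (\<Union> (?A ` ?D)) = (\<Sum>d\<in>?D. card (?A d))"
    using unique by (intro card_UN_disjoint) auto
  finally have "int (card {S \<in> W m k. m \<in> S})
      = int (card (chain_sets m k)) + ((\<Sum>d\<in>?D. int (card (?A d))) + int (card ?T))"
    by (simp only: of_nat_add of_nat_sum)
  moreover have "(\<Sum>d\<in>?D. int (card (?A d))) = (\<Sum>d\<in>?D. B Q (m - d - 1) (k - 2))"
    by (intro sum.cong refl card_pair_cluster) simp_all
  ultimately show ?thesis
    by (simp only: card_triple_cluster add.assoc)
qed

section \<open>The recurrence over the gap set\<close>

text \<open>The split is by whether the last possible comb position \<open>n - q\<close> is
  occupied; if it is not, a board of length \<open>n - 1\<close> offers the same positions.\<close>

lemma B_step:
  "B Q n k = kdelta n 0 * kdelta k 0 + B Q (n - 1) k + int (card {S \<in> W (n - q) k. n - q \<in> S})"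
proof (cases "1 \<le> n")
  case True
  have "{S \<in> W (n - q) k. n - q \<notin> S} = W (n - q - 1) k"
  proof -
    have "{1..n - q - 1} = {1..n - q} - {n - q}"
      by auto
    then show ?thesis
      unfolding avoiding_sets_def by blast
  qed
  moreover have "card (W (n - q) k)
      = card {S \<in> W (n - q) k. n - q \<notin> S} + card {S \<in> W (n - q) k. n - q \<in> S}"
    by (subst card_Un_disjoint[symmetric]) (auto intro: arg_cong[where f = card])
  ultimately show ?thesis
    using True by (simp add: B_W kdelta_def algebra_simps)
next
  case False
  \<comment> \<open>Now \<open>n \<le> 0\<close> and no comb fits: for \<open>n = 0\<close> the
    empty tiling accounts for the delta term, for \<open>n < 0\<close> everything vanishes.\<close>
  have q: "0 < q"
    using l_pos l2_le by simp
  then have "{S \<in> W (n - q) k. n - q \<in> S} = {}"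
    using False by (auto simp: avoiding_sets_nonpos)
  then show ?thesis
    using False q by (auto simp: B_W kdelta_def avoiding_sets_nonpos)
qed

lemma B_chain:
  "B Q n k = kdelta n 0 * kdelta k 0 + B Q (n - 1) k + int (card (chain_sets (n - q) k))
    + (\<Sum>d\<in>P - {2 * l}. B Q (n - q - d - 1) (k - 2)) + B Q (n - q - 2 * l - 1) (k - 3)"
  using B_step[of n k] card_W_top[of "n - q" k] by simp

text \<open>Subtracting \<open>B_chain\<close> at \<open>(n - 2 * l, k - 1)\<close> from
  \<open>B_chain\<close> at \<open>(n, k)\<close> eliminates the chains: by
  \<open>card_chain_sets\<close> their counts differ by \<open>B Q (n - q - 1) (k - 1)\<close>. The
  shifted instance produces all the negative terms.\<close>

lemma B_recurrence:
  "B Q n k = kdelta n 0 * kdelta k 0 - kdelta n (2 * l) * kdelta k 1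
      + B Q (n - 1) k + B Q (n - 2 * l) (k - 1) - B Q (n - 2 * l - 1) (k - 1)
      + B Q (n - q - 1) (k - 1)
      + B Q (n - q - l - 1) (k - 2)
      + B Q (n - q - 2 * l - 1) (k - 3)
      - B Q (n - q - 3 * l - 1) (k - 3)
      - B Q (n - q - 4 * l - 1) (k - 4)
      + (\<Sum>d\<in>P - {l, 2 * l}. B Q (n - q - d - 1) (k - 2) - B Q (n - q - 2 * l - d - 1) (k - 3))"
proof -
  \<comment> \<open>Splitting off \<open>d = l\<close> yields the separate terms at
    \<open>n - q - l - 1\<close> and \<open>n - q - 3 * l - 1\<close>.\<close>
  have sum_l: "(\<Sum>d\<in>P - {2 * l}. g d) = g l + (\<Sum>d\<in>P - {l, 2 * l}. g d)" for g :: "int \<Rightarrow> int"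
  proof -
    have "P - {2 * l} - {l} = P - {l, 2 * l}"
      by blast
    then show ?thesis
      using sum.remove[of "P - {2 * l}" l g] l_in l_pos by simp
  qed
  have shift: "kdelta (n - 2 * l) 0 * kdelta (k - 1) 0 = kdelta n (2 * l) * kdelta k 1"
    by (simp add: kdelta_def)
  have arith: "n - 2 * l - q = n - q - 2 * l" "n - q - 2 * l - 2 * l = n - q - 4 * l"
    "n - q - 2 * l - l = n - q - 3 * l" "k - 1 - 2 = k - 3" "k - 1 - 3 = k - 4"
    by simp_all
  show ?thesis
    using B_chain[of n k] B_chain[of "n - 2 * l" "k - 1"] card_chain_sets[of "n - q" k]
    unfolding sum_l shift sum_subtractf arith by linarith
qed

end

section \<open>From the enumeration \<open>p\<close> to the gap set\<close>

theorem theorem7: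
  fixes Q :: "nat set" and q a l :: nat and p :: "nat \<Rightarrow> nat" and n k :: int
  assumes "finite Q" and "Q \<noteq> {}" and "\<forall>x\<in>Q. 0 < x"
    and "q = Max Q"
    and "a = card ({1..q} - Q)"
    and "strict_mono_on {1..a} p" and "p ` {1..a} = {1..q} - Q"
    and "1 \<le> a" and "p 1 = l" and "p a = 2 * l"
    and "int q = 4 * int l - 1 \<or>
         (int (p (a - 1)) \<le> int q - 2 * int l \<and> int q < 4 * int l - 1)"
  shows "B Q n k =
      kdelta n 0 * kdelta k 0 - kdelta n (2 * int l) * kdelta k 1
      + B Q (n - 1) k + B Q (n - 2 * int l) (k - 1) - B Q (n - 2 * int l - 1) (k - 1)
      + B Q (n - int q - 1) (k - 1)
      + B Q (n - int q - int l - 1) (k - 2)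
      + B Q (n - int q - 2 * int l - 1) (k - 3)
      - B Q (n - int q - 3 * int l - 1) (k - 3)
      - B Q (n - int q - 4 * int l - 1) (k - 4)
      + (\<Sum>i = 2..a - 1. B Q (n - int q - int (p i) - 1) (k - 2)
                         - B Q (n - int q - 2 * int l - int (p i) - 1) (k - 3))"
proof -
  let ?P = "int ` ({1..q} - Q)"
  have mono: "p i < p j" if "1 \<le> i" "i < j" "j \<le> a" for i j
    using assms(6) that by (auto simp: strict_mono_on_def)
  have p_mem: "p i \<in> {1..q} - Q" if "1 \<le> i" "i \<le> a" for i
    using assms(7) that by (metis atLeastAtMost_iff image_eqI)
  have p_surj: "\<exists>i. 1 \<le> i \<and> i \<le> a \<and> x = p i" if "x \<in> {1..q} - Q" for x
    using that unfolding assms(7)[symmetric] by auto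
  have "0 < l"
    using p_mem[of 1] assms(8,9) by auto
  have "2 \<le> a"
    using assms(8,9,10) \<open>0 < l\<close> by (cases "a = 1") auto
  have bounds: "l \<le> p i \<and> p i \<le> 2 * l" if "1 \<le> i" "i \<le> a" for i
    using mono[of 1 i] mono[of i a] assms(9,10) that by (cases "i = 1"; cases "i = a") auto
  have below: "p i \<le> p (a - 1)" if "1 \<le> i" "i < a" for i
  proof -
    have "i = a - 1 \<or> i < a - 1"
      using that(2) by linarith
    then show ?thesis
      using mono[of i "a - 1"] that(1) by auto
  qed
  \<comment> \<open>Under (a), \<open>p i \<le> 2 * l - 1\<close> and \<open>p j \<le> 2 * l\<close>
    add up to at most \<open>4 * l - 1 = q\<close>. Under (b),
    \<open>p i \<le> p (a - 1) \<le> q - 2 * l\<close>.\<close>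
  have sum_le: "p i + p j \<le> q" if "1 \<le> i" "i < a" "1 \<le> j" "j \<le> a" for i j
    using below[OF that(1,2)] bounds[OF that(3,4)] mono[of i a] that(1,2) assms(10,11) by linarith
  interpret comb_gaps Q "int q" "int l" ?P
  proof
    show "?P = {1..int q} - int ` Q"
      by (simp add: image_set_diff image_int_atLeastAtMost)
    show "int l \<in> ?P"
      using p_mem[of 1] assms(8,9) by simp
    have "int (2 * l) \<in> ?P"
      using p_mem[of a] assms(8,10) by (intro imageI) simp
    then show "2 * int l \<in> ?P"
      by simp
    show "int l \<le> d \<and> d \<le> 2 * int l" if "d \<in> ?P" for d
      using that p_surj bounds by fastforce
    show "d + e \<le> int q \<or> d = 2 * int l \<and> e = 2 * int l" if de: "d \<in> ?P" "e \<in> ?P" for d e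
    proof -
      obtain i where "1 \<le> i" "i \<le> a" "d = int (p i)"
        using de(1) p_surj by blast
      moreover obtain j where "1 \<le> j" "j \<le> a" "e = int (p j)"
        using de(2) p_surj by blast
      \<comment> \<open>Unless both indices are \<open>a\<close>, one of them is smaller and
        \<open>sum_le\<close> applies, in one order or the other.\<close>
      ultimately show ?thesis
        using sum_le[of i j] sum_le[of j i] assms(10) by (cases "i = a"; cases "j = a") auto
    qed
    show "int q < 4 * int l"
      using assms(11) by linarith
    show "int q = int (Max Q)"
      by (simp only: assms(4))
  qed (fact assms(1))
  have inj: "inj_on (\<lambda>i. int (p i)) {2..a - 1}"
    using inj_on_subset[OF strict_mono_on_imp_inj_on[OF assms(6)], of "{2..a - 1}"]
    by (auto simp: inj_on_def)
  \<comment> \<open>The indices \<open>1\<close> and \<open>a\<close> carry \<open>l\<close> and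
    \<open>2 * l\<close>, so the inner indices enumerate the other gaps; for \<open>a = 2\<close>
    both sides are empty.\<close>
  have img: "(\<lambda>i. int (p i)) ` {2..a - 1} = ?P - {int l, 2 * int l}"
  proof (intro equalityI subsetI)
    fix x assume "x \<in> (\<lambda>i. int (p i)) ` {2..a - 1}"
    then obtain i where i: "x = int (p i)" "2 \<le> i" "i < a"
      using \<open>2 \<le> a\<close> by auto
    then have "l < p i" "p i < 2 * l" "p i \<in> {1..q} - Q"
      using mono[of 1 i] mono[of i a] p_mem[of i] assms(9,10) by auto
    then show "x \<in> ?P - {int l, 2 * int l}"
      using i(1) by auto
  next
    fix x assume x: "x \<in> ?P - {int l, 2 * int l}"
    then obtain i where i: "x = int (p i)" "1 \<le> i" "i \<le> a"
      using p_surj by blast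
    have "i \<noteq> 1" "i \<noteq> a"
      using x i assms(9,10) by auto
    then show "x \<in> (\<lambda>i. int (p i)) ` {2..a - 1}"
      using i by auto
  qed
  show ?thesis
    using B_recurrence[of n k] unfolding img[symmetric] sum.reindex[OF inj] by simp
qed

end
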